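(* Let $E,F$ be Banach spaces and suppose that $T_0\in B^+(E,F)$ with $N(T_0)\oplus R_0=E$, that $E=E_*\oplus R_0$, and that $\dim R_0>0$. Then $T_0$ and $T_0P_{R_0}^{E_*}$ are path connected in the set $$S=\{T\in B^+(E,F) : N(T)\oplus R_0=E \text{ and } R(T)=R(T_0)\}.$$
   Context: $B(E,F)$ denotes the set of all bounded linear operators from $E$ to $F$ with the operator norm; $R(T)$ and $N(T)$ denote the range and kernel of $T$. $B^+(E,F)$ denotes the set of double splitting operators in $B(E,F)$, i.e. those $T$ whose kernel $N(T)$ is a closed complemented subspace of $E$ and whose range $R(T)$ is a closed complemented subspace of $F$. Decompositions $A\oplus B$ are topological direct sums of closed subspaces, and $P_A^B$ denotes the bounded projection onto $A$ with kernel $B$. Two operators $T_0,T_1$ in a set $S\subset B(E,F)$ are said to be path connected in $S$ if there is a (norm-continuous) path $\omega(t)\in S$, $t\in[0,1]$, with $\omega(0)=T_0$ and $\omega(1)=T_1$. *)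

theory Defs
  imports "HOL-Analysis.Analysis" "HOL-Library.Extended_Nat"
begin

definition null_space :: "('a::real_normed_vector \<Rightarrow>\<^sub>L 'b::real_normed_vector) \<Rightarrow> 'a set" where
  "null_space T = {x. blinfun_apply T x = 0}"

(* The whole space is the topological direct sum of the closed subspaces A and B:
   the addition map from A \<times> B is a bijection whose inverse is also continuous. *)
definition topological_direct_sum :: "'a::real_normed_vector set \<Rightarrow> 'a set \<Rightarrow> bool" where
  "topological_direct_sum A B \<longleftrightarrow>
     subspace A \<and> closed A \<and> subspace B \<and> closed B \<and>
     (\<exists>g. homeomorphism (A \<times> B) UNIV (\<lambda>(a, b). a + b) g)"

definition complemented :: "'a::real_normed_vector set \<Rightarrow> bool" where
  "complemented A \<longleftrightarrow> (\<exists>B. topological_direct_sum A B)"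

definition double_splitting :: "('a::real_normed_vector \<Rightarrow>\<^sub>L 'b::real_normed_vector) set" where
  "double_splitting = {T. complemented (null_space T) \<and> complemented (range (blinfun_apply T))}"

(* The bounded projection onto A with kernel B. It is unique if it exists, and it exists
   exactly if the whole space is the topological direct sum of A and B. *)
definition projection_along :: "'a::real_normed_vector set \<Rightarrow> 'a set \<Rightarrow> 'a \<Rightarrow>\<^sub>L 'a" where
  "projection_along A B =
     (THE P. P o\<^sub>L P = P \<and> range (blinfun_apply P) = A \<and> null_space P = B)"

(* dim is a natural number and carries no information for infinite-dimensional subspaces,
   so these get the value \<infinity>. *)
definition subspace_dim :: "'a::real_vector set \<Rightarrow> enat" where
  "subspace_dim V = (if \<exists>B. finite B \<and> span B = V then enat (dim V) else \<infinity>)"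

end

theory Submission
  imports Defs
begin

text \<open>
  Write \<open>Q\<close> and \<open>P\<close> for the bounded projections onto \<open>R0\<close> along the kernel of \<open>T0\<close> and along
  \<open>Estar\<close>. Two projections onto the same subspace satisfy \<open>P Q = Q\<close> and \<open>Q P = P\<close>, so every
  affine combination of them is again a projection onto \<open>R0\<close>. Since \<open>T0 = T0 Q\<close>, the segment
  \<open>T0 ((1 - t) Q + t P)\<close> joins \<open>T0\<close> to \<open>T0 P\<close>. It stays in the required set because \<open>T0\<close> is
  injective on \<open>R0\<close> and maps \<open>R0\<close> onto its whole range: composing \<open>T0\<close> with a projection
  onto \<open>R0\<close> therefore keeps the range of \<open>T0\<close> and has the kernel of the projection, which is a
  topological complement of \<open>R0\<close>.
\<close>

text \<open>
  Continuity at the origin gives \<open>\<delta>\<close> such that the ball of radius \<open>\<delta>\<close> is mapped into the unit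
  ball; scaling every other vector into that ball yields a bound for the operator norm.
\<close>

lemma bounded_linear_if_linear_continuous:
  fixes f :: "'a::real_normed_vector \<Rightarrow> 'b::real_normed_vector"
  assumes "linear f" and "continuous_on UNIV f"
  shows "bounded_linear f"
proof -
  interpret linear f by fact
  have "isCont f 0"
    using assms(2) by (simp add: continuous_on_eq_continuous_at)
  then obtain \<delta> where "\<delta> > 0" and \<delta>: "\<And>x. norm x < \<delta> \<Longrightarrow> norm (f x) < 1"
    unfolding continuous_at_eps_delta
    by (auto simp: dist_norm dest: spec[of _ 1])
  show ?thesis
  proof (rule bounded_linear_intro)
    fix x
    show "norm (f x) \<le> norm x * (2 / \<delta>)"
    proof (cases "x = 0")
      case False
      define c where "c = \<delta> / (2 * norm x)"
      have c: "c > 0" using False \<open>\<delta> > 0\<close> by (simp add: c_def)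
      have "norm (c *\<^sub>R x) < \<delta>"
        using False \<open>\<delta> > 0\<close> by (simp add: c_def)
      then have "c * norm (f x) < 1"
        using \<delta>[of "c *\<^sub>R x"] c by (simp add: scale)
      then show ?thesis
        using False \<open>\<delta> > 0\<close> by (simp add: c_def field_simps)
    qed simp
  qed (simp_all add: add scale)
qed

definition is_projection :: "('a::real_normed_vector \<Rightarrow>\<^sub>L 'a) \<Rightarrow> 'a set \<Rightarrow> 'a set \<Rightarrow> bool" where
  "is_projection P A B \<longleftrightarrow> P o\<^sub>L P = P \<and> range (blinfun_apply P) = A \<and> null_space P = B"

lemma is_projection_idempotent:
  assumes "is_projection P A B"
  shows "P (P x) = P x"
proof -
  have "(P o\<^sub>L P) x = P x"
    using assms by (simp add: is_projection_def)
  then show ?thesis by simp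
qed

lemma is_projection_fixes:
  assumes "is_projection P A B" and "x \<in> A"
  shows "P x = x"
  using assms(2) is_projection_idempotent[OF assms(1)] assms(1)
  by (auto simp: is_projection_def)

lemma is_projection_kills_complement:
  assumes "is_projection P A B"
  shows "x - P x \<in> B"
  using is_projection_idempotent[OF assms, of x] assms
  by (auto simp: is_projection_def null_space_def blinfun.diff_right)

lemma is_projection_unique:
  assumes P: "is_projection P A B" and Q: "is_projection Q A B"
  shows "P = Q"
proof (rule blinfun_eqI)
  fix x
  \<comment> \<open>\<open>Q\<close> kills \<open>x - P x\<close> and fixes \<open>P x\<close>.\<close>
  have "Q (x - P x) = 0"
    using is_projection_kills_complement[OF P] Q by (auto simp: is_projection_def null_space_def)
  moreover have "Q (P x) = P x"
    using is_projection_fixes[OF Q] P by (auto simp: is_projection_def)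
  ultimately show "P x = Q x"
    by (simp add: blinfun.diff_right)
qed

lemma projection_along_eq:
  assumes "is_projection P A B"
  shows "projection_along A B = P"
  unfolding projection_along_def is_projection_def[symmetric]
  using assms is_projection_unique by blast

text \<open>
  The second component of the inverse of the addition map is the projection onto the second
  summand. It is continuous because that inverse is, and linear because decompositions
  are unique.
\<close>

lemma topological_direct_sum_projection:
  fixes A B :: "'a::real_normed_vector set"
  assumes "topological_direct_sum A B"
  obtains P where "is_projection P B A"
proof -
  from assms obtain g where A: "subspace A" and B: "subspace B"
    and hom: "homeomorphism (A \<times> B) UNIV (\<lambda>(a, b). a + b) g"
    unfolding topological_direct_sum_def by blast
  define p where "p x = snd (g x)" for x
  have decomp: "p x \<in> B" "x - p x \<in> A" for x
  proof -
    have "range g = A \<times> B" and "fst (g x) + snd (g x) = x"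
      using hom by (auto simp: homeomorphism_def case_prod_unfold)
    moreover from this have "g x \<in> A \<times> B"
      by blast
    ultimately show "p x \<in> B" "x - p x \<in> A"
      by (auto simp: p_def mem_Times_iff eq_diff_eq[symmetric])
  qed
  have p_sum: "p (a + b) = b" if "a \<in> A" "b \<in> B" for a b
  proof -
    have "g (a + b) = (a, b)"
      using hom that unfolding homeomorphism_def by fastforce
    then show ?thesis by (simp add: p_def)
  qed
  have "linear p"
  proof (rule linearI)
    fix x y
    have "(x - p x) + (y - p y) \<in> A" "p x + p y \<in> B"
      using decomp A B by (auto intro: subspace_add)
    from p_sum[OF this] show "p (x + y) = p x + p y"
      by (simp add: algebra_simps)
  next
    fix r x
    have "r *\<^sub>R (x - p x) \<in> A" "r *\<^sub>R p x \<in> B"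
      using decomp A B by (auto intro: subspace_scale)
    from p_sum[OF this] show "p (r *\<^sub>R x) = r *\<^sub>R p x"
      by (simp add: algebra_simps)
  qed
  moreover have "continuous_on UNIV p"
    unfolding p_def using hom by (auto simp: homeomorphism_def intro: continuous_on_snd)
  ultimately have "bounded_linear p"
    by (rule bounded_linear_if_linear_continuous)
  then have app: "blinfun_apply (Blinfun p) = p"
    by (rule bounded_linear_Blinfun_apply)
  have pB: "p b = b" if "b \<in> B" for b
    using p_sum[of 0 b] that A by (simp add: subspace_0)
  have pA: "p a = 0" if "a \<in> A" for a
    using p_sum[of a 0] that B by (simp add: subspace_0)
  have "Blinfun p o\<^sub>L Blinfun p = Blinfun p"
    by (rule blinfun_eqI) (simp add: app pB decomp)
  moreover have "range p = B"
    using decomp pB by (metis image_subset_iff rangeI subsetI subset_antisym)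
  moreover have "p x = 0 \<longleftrightarrow> x \<in> A" for x
    using pA decomp(2)[of x] by auto
  ultimately have "is_projection (Blinfun p) B A"
    by (simp add: is_projection_def null_space_def app)
  then show ?thesis by (rule that)
qed

text \<open>The inverse of the addition map is \<open>x \<mapsto> (x - P x, P x)\<close>.\<close>

lemma is_projection_topological_direct_sum:
  assumes P: "is_projection P A B"
  shows "topological_direct_sum B A"
proof -
  have B: "B = {x. P x = 0}"
    using P by (auto simp: is_projection_def null_space_def)
  have A: "A = {x. P x = x}"
    using is_projection_idempotent[OF P] P
    by (auto simp: is_projection_def intro: range_eqI[OF sym])
  have "closed B" "closed A"
    unfolding A B by (intro closed_Collect_eq continuous_intros)+
  moreover have "subspace B" "subspace A"
    unfolding A B subspace_def by (auto simp: blinfun.bilinear_simps)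
  moreover have "homeomorphism (B \<times> A) UNIV (\<lambda>(a, b). a + b) (\<lambda>x. (x - P x, P x))"
  proof (rule homeomorphismI)
    show "continuous_on (B \<times> A) (\<lambda>(a, b). a + b)"
      unfolding case_prod_unfold by (intro continuous_intros)
    show "continuous_on UNIV (\<lambda>x. (x - P x, P x))"
      by (intro continuous_intros)
    show "range (\<lambda>x. (x - P x, P x)) \<subseteq> B \<times> A"
      using P is_projection_kills_complement[OF P] by (auto simp: is_projection_def)
  qed (auto simp: A B blinfun.bilinear_simps)
  ultimately show ?thesis
    unfolding topological_direct_sum_def by blast
qed

text \<open>
  Both projections map into \<open>A\<close> and fix it pointwise, and these two properties, which
  characterise idempotents with range \<open>A\<close>, survive affine combinations. Only the kernel
  moves with \<open>t\<close>.
\<close>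

lemma is_projection_affine_combination:
  assumes P: "is_projection P A B" and Q: "is_projection Q A C"
  defines "Z \<equiv> \<lambda>t::real. (1 - t) *\<^sub>R Q + t *\<^sub>R P"
  shows "is_projection (Z t) A (null_space (Z t))"
proof -
  have apply_Z: "Z t x = (1 - t) *\<^sub>R Q x + t *\<^sub>R P x" for x
    by (simp add: Z_def blinfun.bilinear_simps)
  have fixes_A: "Z t x = x" if "x \<in> A" for x
    using is_projection_fixes[OF P that] is_projection_fixes[OF Q that]
    by (simp add: apply_Z flip: scaleR_add_left)
  have "subspace A"
    using is_projection_topological_direct_sum[OF P] by (simp add: topological_direct_sum_def)
  then have into_A: "Z t x \<in> A" for x
    using P Q by (auto simp: apply_Z is_projection_def intro!: subspace_add subspace_scale)
  have "Z t o\<^sub>L Z t = Z t"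
    by (rule blinfun_eqI) (simp add: fixes_A into_A)
  moreover have "range (Z t) = A"
    using fixes_A into_A by (metis image_subset_iff rangeI subsetI subset_antisym)
  ultimately show ?thesis
    by (simp add: is_projection_def)
qed

theorem theorem1p4:
  fixes T0 :: "'e::banach \<Rightarrow>\<^sub>L 'f::banach"
    and R0 Estar :: "'e set"
  assumes "T0 \<in> double_splitting"
    and "topological_direct_sum (null_space T0) R0"
    and "topological_direct_sum Estar R0"
    and "subspace_dim R0 > 0"
  shows "path_component
           {T \<in> double_splitting. topological_direct_sum (null_space T) R0 \<and>
              range (blinfun_apply T) = range (blinfun_apply T0)}
           T0 (T0 o\<^sub>L projection_along R0 Estar)"
proof -
  obtain Q where Q: "is_projection Q R0 (null_space T0)"
    using assms(2) by (rule topological_direct_sum_projection)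
  obtain P where P: "is_projection P R0 Estar"
    using assms(3) by (rule topological_direct_sum_projection)
  have T0_Q: "T0 (Q x) = T0 x" for x
    using is_projection_kills_complement[OF Q, of x]
    by (simp add: null_space_def blinfun.diff_right)
  \<comment> \<open>\<open>Q\<close> has the same kernel as \<open>T0\<close> and fixes \<open>R0\<close>.\<close>
  have T0_inj: "x = 0" if "x \<in> R0" "T0 x = 0" for x
  proof -
    have "x \<in> null_space Q"
      using Q that(2) by (simp add: is_projection_def null_space_def)
    then show "x = 0"
      using is_projection_fixes[OF Q that(1)] by (simp add: null_space_def)
  qed
  have T0_R0: "T0 ` R0 = range T0"
  proof -
    have "T0 ` R0 = range (\<lambda>x. T0 (Q x))"
      using Q by (auto simp: is_projection_def)
    then show ?thesis by (simp add: T0_Q)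
  qed
  define Z where "Z t = (1 - t) *\<^sub>R Q + t *\<^sub>R P" for t :: real
  define \<omega> where "\<omega> t = T0 o\<^sub>L Z t" for t
  have Z: "is_projection (Z t) R0 (null_space (Z t))" for t
    unfolding Z_def by (rule is_projection_affine_combination[OF P Q])
  have range_\<omega>: "range (\<omega> t) = range T0" for t
  proof -
    have "range (\<omega> t) = T0 ` range (Z t)"
      by (auto simp: \<omega>_def)
    also have "range (Z t) = R0"
      using Z by (simp add: is_projection_def)
    finally show ?thesis by (simp add: T0_R0)
  qed
  have "null_space (\<omega> t) = null_space (Z t)" for t
    using T0_inj Z[of t] by (auto simp: \<omega>_def null_space_def is_projection_def)
  then have sum_\<omega>: "topological_direct_sum (null_space (\<omega> t)) R0" for t
    using is_projection_topological_direct_sum[OF Z] by simp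
  have \<omega>_splits: "\<omega> t \<in> double_splitting" for t
    using assms(1) sum_\<omega>[of t] range_\<omega>[of t]
    by (auto simp: double_splitting_def complemented_def)
  have "path \<omega>"
    unfolding path_def \<omega>_def Z_def
    by (intro continuous_intros bounded_linear.continuous_on[OF
        bounded_bilinear.bounded_linear_right[OF bounded_bilinear_blinfun_compose]])
  moreover have "\<omega> 0 = T0"
    by (rule blinfun_eqI) (simp add: \<omega>_def Z_def T0_Q)
  moreover have "\<omega> 1 = T0 o\<^sub>L projection_along R0 Estar"
    by (simp add: \<omega>_def Z_def projection_along_eq[OF P])
  ultimately show ?thesis
    unfolding path_component_def path_image_def pathstart_def pathfinish_def
    using range_\<omega> sum_\<omega> \<omega>_splits by blast
qed

end
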